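(* Let $R$ be a semi-nil clean ring. Suppose that the set ${\rm Nil}(R)$ of nilpotent elements of $R$ is an additive subgroup of $R$ and has bounded index of nilpotence, that is, there exists a positive integer $d$ such that $x^d=0$ for every $x\in{\rm Nil}(R)$. Then $R$ is periodic.
   Context: Rings are associative with identity, not necessarily commutative. An element $x$ of a ring $R$ is periodic if there exist two different positive integers $m\neq n$ with $x^m=x^n$; a ring is periodic if all its elements are periodic. A ring is semi-nil clean if each of its elements is the sum of a periodic element and a nilpotent element (no commutation required). *)

theory Defs
  imports "HOL-Algebra.Algebra"
begin

definition periodic_elem :: "('a, 'b) ring_scheme \<Rightarrow> 'a \<Rightarrow> bool" where
  "periodic_elem R x \<longleftrightarrow>
     (\<exists>m n :: nat. m > 0 \<and> n > 0 \<and> m \<noteq> n \<and> x [^]\<^bsub>R\<^esub> m = x [^]\<^bsub>R\<^esub> n)"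

definition nilpotents :: "('a, 'b) ring_scheme \<Rightarrow> 'a set" where
  "nilpotents R = {x \<in> carrier R. \<exists>n :: nat. n > 0 \<and> x [^]\<^bsub>R\<^esub> n = \<zero>\<^bsub>R\<^esub>}"

definition periodic_ring :: "('a, 'b) ring_scheme \<Rightarrow> bool" where
  "periodic_ring R \<longleftrightarrow> ring R \<and> (\<forall>x \<in> carrier R. periodic_elem R x)"

definition semi_nil_clean_ring :: "('a, 'b) ring_scheme \<Rightarrow> bool" where
  "semi_nil_clean_ring R \<longleftrightarrow> ring R \<and>
     (\<forall>x \<in> carrier R. \<exists>p \<in> carrier R. \<exists>q \<in> nilpotents R. periodic_elem R p \<and> x = p \<oplus>\<^bsub>R\<^esub> q)"

end

theory Submission
  imports Defs
begin

text \<open>The key point is that additively closed nilpotents are multiplicatively closed. Let \<open>S\<close> be the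
  set of sums of products of nilpotents (including \<open>1\<close>) and \<open>I\<close> the set of all \<open>x\<close> with \<open>x S\<close> nil.
  If \<open>w \<in> S\<close> is such that \<open>a w\<close> is nilpotent whenever \<open>a\<^sup>2 \<in> I\<close>, then also \<open>a w a \<in> I\<close> for these \<open>a\<close>;
  comparing \<open>a w c\<^sup>m = 0\<close> for the nilpotent
  \<open>c = a w y + y a w\<close> with \<open>(a w y)\<^sup>m a w\<close> modulo \<open>I\<close> shows that \<open>a w y\<close> is nilpotent for nilpotent
  \<open>y\<close>. Hence \<open>a\<^sup>2 \<in> I\<close> implies \<open>a \<in> I\<close>, and every nilpotent lies in \<open>I\<close>.

  Now let \<open>x\<close> be periodic plus nilpotent. Moving a nilpotent part of the periodic summand to the
  other summand gives \<open>x = u + s\<close> with \<open>u\<^sup>k = e\<close> idempotent, \<open>e u = u\<close> and \<open>s\<close> nilpotent.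
  Multiplication by \<open>u\<close> preserves nilpotency: \<open>(u s)\<^sup>k\<close> is a product of conjugates of \<open>s\<close>. So
  \<open>x\<^sup>j - u\<^sup>j\<close> is nilpotent for every \<open>j\<close>, and in particular \<open>x\<^sup>2\<^sup>k - x\<^sup>k\<close> is nilpotent. The case
  \<open>x = 2\<close> shows that the characteristic \<open>c\<close> is positive, and iterating \<open>z \<mapsto> z\<^sup>c\<close> turns the
  nilpotent difference of the commuting elements \<open>x\<^sup>2\<^sup>k\<close> and \<open>x\<^sup>k\<close> into \<open>0\<close>.\<close>

context ring
begin

section \<open>Nilpotent elements in an arbitrary ring\<close>

lemma nilpotents_closed: "x \<in> nilpotents R \<Longrightarrow> x \<in> carrier R"
  by (simp add: nilpotents_def)

lemma nilpotentsE:
  assumes "x \<in> nilpotents R"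
  obtains n :: nat where "n > 0" "x [^] n = \<zero>"
  using assms by (auto simp: nilpotents_def)

lemma nilpotentsI:
  assumes "x \<in> carrier R" "x [^] (n::nat) = \<zero>"
  shows "x \<in> nilpotents R"
proof -
  have "x [^] Suc n = \<zero>" using assms by simp
  then show ?thesis using assms(1) unfolding nilpotents_def by blast
qed

lemma nilpotents_pow_imp:
  assumes "x \<in> carrier R" "x [^] (n::nat) \<in> nilpotents R"
  shows "x \<in> nilpotents R"
proof -
  obtain j :: nat where "(x [^] n) [^] j = \<zero>" using assms(2) by (rule nilpotentsE)
  then have "x [^] (n * j) = \<zero>" using assms(1) by (simp add: nat_pow_pow)
  then show ?thesis using assms(1) by (rule nilpotentsI[rotated])
qed

lemma pow_mult_swap:
  assumes "a \<in> carrier R" "b \<in> carrier R"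
  shows "(b \<otimes> a) [^] Suc n = b \<otimes> (a \<otimes> b) [^] n \<otimes> a"
proof (induction n)
  case 0
  then show ?case using assms by simp
next
  case (Suc n)
  have "(b \<otimes> a) [^] Suc (Suc n) = b \<otimes> (a \<otimes> b) [^] n \<otimes> a \<otimes> (b \<otimes> a)"
    using Suc by simp
  also have "\<dots> = b \<otimes> (a \<otimes> b) [^] Suc n \<otimes> a"
    using assms by (simp add: m_assoc)
  finally show ?case .
qed

lemma nilpotents_swap:
  assumes "a \<otimes> b \<in> nilpotents R" "a \<in> carrier R" "b \<in> carrier R"
  shows "b \<otimes> a \<in> nilpotents R"
proof -
  obtain n :: nat where "(a \<otimes> b) [^] n = \<zero>" using assms(1) by (rule nilpotentsE)
  then have "(b \<otimes> a) [^] Suc n = \<zero>" using assms by (simp only: pow_mult_swap) simp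
  then show ?thesis using assms by (intro nilpotentsI[of _ "Suc n"]) auto
qed

section \<open>The span of the nilpotents and its nil core\<close>

inductive_set nil_span :: "'a set" where
  one: "\<one> \<in> nil_span"
| mult: "s \<in> nil_span \<Longrightarrow> y \<in> nilpotents R \<Longrightarrow> s \<otimes> y \<in> nil_span"
| add: "s \<in> nil_span \<Longrightarrow> t \<in> nil_span \<Longrightarrow> s \<oplus> t \<in> nil_span"

lemma nil_span_closed: "s \<in> nil_span \<Longrightarrow> s \<in> carrier R"
  by (induction rule: nil_span.induct) (auto dest: nilpotents_closed)

text \<open>This makes \<open>nil_span\<close> the subsemiring generated by 1 and the nilpotents.
  Its product rule appends a single nilpotent on the right, which is the shape needed for the
  induction in \<open>square_in_nil_core_mult\<close>.\<close>

lemma nil_span_mult: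
  assumes "s \<in> nil_span" "t \<in> nil_span"
  shows "s \<otimes> t \<in> nil_span"
  using assms(2)
proof (induction rule: nil_span.induct)
  case one
  then show ?case using assms(1) by (simp add: nil_span_closed)
next
  case (mult t y)
  then have "s \<otimes> t \<otimes> y \<in> nil_span" by (simp add: nil_span.mult)
  then show ?case using assms(1) mult by (simp add: m_assoc nil_span_closed nilpotents_closed)
next
  case (add t t')
  then have "s \<otimes> t \<oplus> s \<otimes> t' \<in> nil_span" by (intro nil_span.add)
  then show ?case using assms(1) add by (simp add: r_distr nil_span_closed)
qed

lemma nilpotents_subset_nil_span: "y \<in> nilpotents R \<Longrightarrow> y \<in> nil_span"
  using nil_span.mult[OF nil_span.one] by (simp add: nilpotents_closed)

lemma nil_span_pow: "s \<in> nil_span \<Longrightarrow> s [^] (n::nat) \<in> nil_span"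
  by (induction n) (auto intro: nil_span.one nil_span_mult)

text \<open>Although defined by products on one side, this set absorbs \<open>nil_span\<close> on both sides, because
  \<open>x y\<close> is nilpotent iff \<open>y x\<close> is.\<close>

definition nil_core :: "'a set" where
  "nil_core = {x \<in> carrier R. \<forall>s \<in> nil_span. x \<otimes> s \<in> nilpotents R}"

lemma nil_core_closed: "x \<in> nil_core \<Longrightarrow> x \<in> carrier R"
  by (simp add: nil_core_def)

lemma nil_core_mult_nil_span:
  "x \<in> nil_core \<Longrightarrow> s \<in> nil_span \<Longrightarrow> x \<otimes> s \<in> nil_core"
  by (auto simp: nil_core_def m_assoc nil_span_closed nil_span_mult)

lemma nil_span_mult_nil_core:
  assumes "x \<in> nil_core" "s \<in> nil_span"
  shows "s \<otimes> x \<in> nil_core"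
proof -
  have "s \<otimes> x \<otimes> t \<in> nilpotents R" if "t \<in> nil_span" for t
  proof -
    have "(x \<otimes> t) \<otimes> s \<in> nilpotents R"
      using nil_span_mult[OF that assms(2)] assms that
      by (auto simp: nil_core_def m_assoc nil_span_closed)
    then show ?thesis
      using assms that nilpotents_swap[of "x \<otimes> t" s]
      by (simp add: m_assoc nil_span_closed nil_core_closed)
  qed
  then show ?thesis using assms by (simp add: nil_core_def nil_span_closed)
qed

lemma nil_core_subset_nilpotents: "x \<in> nil_core \<Longrightarrow> x \<in> nilpotents R"
  using nil_span.one by (force simp: nil_core_def)

section \<open>Idempotent powers and powers of commuting sums\<close>

lemma idempotent_power:
  assumes "p \<in> carrier R" "periodic_elem R p"
  obtains k :: nat where "k \<ge> 2" "p [^] (k + k) = p [^] k"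
proof -
  obtain m n :: nat where mn: "m > 0" "m < n" "p [^] m = p [^] n"
    using assms(2) unfolding periodic_elem_def by (metis linorder_neqE_nat)
  define r where "r = n - m"
  have r: "r > 0" "p [^] (m + r) = p [^] m" using mn by (auto simp: r_def)
  have shift: "p [^] (m + i * r) = p [^] m" for i
  proof (induction i)
    case (Suc i)
    have "p [^] (m + Suc i * r) = p [^] (m + r) \<otimes> p [^] (i * r)"
      using assms(1) by (simp add: nat_pow_mult ac_simps)
    also have "\<dots> = p [^] (m + i * r)" using assms(1) r by (simp add: nat_pow_mult)
    finally show ?case using Suc by simp
  qed simp
  \<comment> \<open>From exponent \<open>m\<close> on, the powers of \<open>p\<close> have period
    \<open>r\<close>, so any multiple of \<open>r\<close> that is at least \<open>m\<close> works.
    The factor 2 ensures \<open>k \<ge> 2\<close>, as \<open>potent_mult_nil\<close>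
    demands.\<close>
  define k where "k = 2 * m * r"
  have "k \<ge> m" using r(1) mn(1) by (cases r) (auto simp: k_def)
  then have "p [^] (k + k) = p [^] (m + (2 * m) * r) \<otimes> p [^] (k - m)"
    using assms(1) by (simp add: nat_pow_mult k_def)
  also have "\<dots> = p [^] m \<otimes> p [^] (k - m)" by (simp only: shift)
  also have "\<dots> = p [^] k" using assms(1) \<open>k \<ge> m\<close> by (simp add: nat_pow_mult)
  finally have "p [^] (k + k) = p [^] k" .
  moreover have "k \<ge> 2" using r(1) mn(1) by (cases r; cases m) (auto simp: k_def)
  ultimately show ?thesis by (rule that[rotated])
qed

text \<open>The binomial expansion modulo w^2. If the exponent is the characteristic, the linear
  term dies. The remainder factor \<open>t\<close> is kept commuting with \<open>y\<close> and
  \<open>w\<close> so that the expansion can be applied repeatedly.\<close>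

lemma pow_add_commuting:
  assumes "y \<in> carrier R" "w \<in> carrier R" "y \<otimes> w = w \<otimes> y"
  shows "\<exists>t \<in> carrier R. t \<otimes> y = y \<otimes> t \<and> t \<otimes> w = w \<otimes> t \<and>
    (y \<oplus> w) [^] Suc n = y [^] Suc n \<oplus> add_pow R (Suc n) (y [^] n \<otimes> w) \<oplus> w \<otimes> w \<otimes> t"
proof (induction n)
  case 0
  then show ?case using assms by (intro bexI[of _ \<zero>]) simp_all
next
  case (Suc n)
  then obtain t where t: "t \<in> carrier R" "t \<otimes> y = y \<otimes> t" "t \<otimes> w = w \<otimes> t"
    "(y \<oplus> w) [^] Suc n = y [^] Suc n \<oplus> add_pow R (Suc n) (y [^] n \<otimes> w) \<oplus> w \<otimes> w \<otimes> t"
    by blast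
  define A where "A = add_pow R (Suc n) (y [^] n)"
  have Ac: "A \<in> carrier R" using assms by (simp add: A_def)
  have yn: "y [^] n \<otimes> w = w \<otimes> y [^] n"
    using assms by (intro group_commutes_pow)
  have Aw: "A \<otimes> w = w \<otimes> A" and Ay: "A \<otimes> y = y \<otimes> A"
    using assms yn nat_pow_Suc2[of y n]
    unfolding A_def by (simp_all only: add_pow_ldistr add_pow_rdistr nat_pow_closed nat_pow_Suc)
  have A1: "add_pow R (Suc n) (y [^] n \<otimes> w) = A \<otimes> w"
    using assms by (simp only: A_def add_pow_ldistr nat_pow_closed)
  have "add_pow R (Suc n) (y [^] Suc n \<otimes> w) = A \<otimes> w \<otimes> y"
  proof -
    have "y [^] Suc n \<otimes> w = y [^] n \<otimes> w \<otimes> y" using assms by (simp add: m_assoc)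
    then show ?thesis
      using assms by (simp only: A_def add_pow_ldistr nat_pow_closed m_closed)
  qed
  then have A2: "add_pow R (Suc (Suc n)) (y [^] Suc n \<otimes> w) = A \<otimes> w \<otimes> y \<oplus> y [^] Suc n \<otimes> w"
    using assms add.nat_pow_Suc[of "Suc n" "y [^] Suc n \<otimes> w"] by simp
  \<comment> \<open>Multiplying the old expansion by \<open>y \<oplus> w\<close>, the linear term
    times \<open>w\<close> contributes \<open>A\<close>, and the old remainder contributes the other
    two summands.\<close>
  define t' where "t' = A \<oplus> t \<otimes> y \<oplus> t \<otimes> w"
  have "t' \<in> carrier R" using Ac t assms by (simp add: t'_def)
  moreover have "t' \<otimes> y = y \<otimes> t'"
  proof -
    have "t \<otimes> y \<otimes> y = y \<otimes> (t \<otimes> y)" "t \<otimes> w \<otimes> y = y \<otimes> (t \<otimes> w)"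
      using t(1,2) assms by (metis m_assoc)+
    then show ?thesis using Ac t(1) assms(1,2) by (simp only: t'_def l_distr r_distr Ay m_closed a_closed)
  qed
  moreover have "t' \<otimes> w = w \<otimes> t'"
  proof -
    have "t \<otimes> y \<otimes> w = w \<otimes> (t \<otimes> y)" "t \<otimes> w \<otimes> w = w \<otimes> (t \<otimes> w)"
      using t(1,3) assms by (metis m_assoc)+
    then show ?thesis using Ac t(1) assms(1,2) by (simp only: t'_def l_distr r_distr Aw m_closed a_closed)
  qed
  moreover have "(y \<oplus> w) [^] Suc (Suc n)
      = y [^] Suc (Suc n) \<oplus> add_pow R (Suc (Suc n)) (y [^] Suc n \<otimes> w) \<oplus> w \<otimes> w \<otimes> t'"
  proof -
    have "(y \<oplus> w) [^] Suc (Suc n) = (y [^] Suc n \<oplus> A \<otimes> w \<oplus> w \<otimes> w \<otimes> t) \<otimes> (y \<oplus> w)"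
      using t(4) A1 by simp
    also have "\<dots> = y [^] Suc (Suc n) \<oplus> (A \<otimes> w \<otimes> y \<oplus> y [^] Suc n \<otimes> w)
        \<oplus> (A \<otimes> w \<otimes> w \<oplus> w \<otimes> w \<otimes> (t \<otimes> y) \<oplus> w \<otimes> w \<otimes> (t \<otimes> w))"
      using Ac t(1) assms(1,2) by (simp add: l_distr r_distr m_assoc a_ac)
    also have "A \<otimes> w \<otimes> w = w \<otimes> w \<otimes> A"
      using Ac assms(2) Aw by (metis m_assoc)
    finally show ?thesis
      using Ac t(1) assms(1,2) by (simp only: A2 t'_def r_distr m_closed a_closed)
  qed
  ultimately show ?case by blast
qed

lemma nat_multiple_one_mult:
  "add_pow R (a::nat) \<one> \<otimes> add_pow R (b::nat) \<one> = add_pow R (a * b) \<one>"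
  by (simp add: add_pow_ldistr add.nat_pow_pow mult.commute)

lemma nat_multiple_one_pow: "(add_pow R (a::nat) \<one>) [^] (n::nat) = add_pow R (a ^ n) \<one>"
proof (induction n)
  case (Suc n)
  then show ?case by (simp add: nat_multiple_one_mult mult.commute)
qed simp

text \<open>Raising to the power \<open>c\<close> replaces the difference \<open>w\<close> by a
  multiple of w^2, which halves the exponent 2^j that kills it. After \<open>j\<close> rounds the
  difference is zero.\<close>

lemma pow_eq_of_nilpotent_difference:
  assumes char: "\<And>x. x \<in> carrier R \<Longrightarrow> add_pow R c x = \<zero>" and "c > (0::nat)"
    and "y \<in> carrier R" "w \<in> carrier R" "y \<otimes> w = w \<otimes> y" "w [^] ((2::nat) ^ j) = \<zero>"
  shows "\<exists>M::nat. M > 0 \<and> (y \<oplus> w) [^] M = y [^] M"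
  using assms(3-)
proof (induction j arbitrary: y w)
  case 0
  then show ?case by (intro exI[of _ 1]) simp
next
  case (Suc j)
  note y = Suc.prems(1) and w = Suc.prems(2) and yw = Suc.prems(3)
  obtain b where b: "c = Suc b" using \<open>c > 0\<close> by (cases c) auto
  obtain t where t: "t \<in> carrier R" "t \<otimes> y = y \<otimes> t" "t \<otimes> w = w \<otimes> t"
    "(y \<oplus> w) [^] c = y [^] c \<oplus> add_pow R c (y [^] b \<otimes> w) \<oplus> w \<otimes> w \<otimes> t"
    using pow_add_commuting[OF y w yw, of b] b by blast
  define v where "v = w \<otimes> w \<otimes> t"
  have v: "v \<in> carrier R" using w t by (simp add: v_def)
  have eq: "(y \<oplus> w) [^] c = y [^] c \<oplus> v"
    using t y w by (simp add: char v_def)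
  have wwt: "(w \<otimes> w) \<otimes> t = t \<otimes> (w \<otimes> w)"
    using w t by (metis m_assoc)
  have yv: "y \<otimes> v = v \<otimes> y"
    unfolding v_def using y w t yw by (metis m_assoc m_closed)
  have ycv: "y [^] c \<otimes> v = v \<otimes> y [^] c"
    using pow_mult_distrib by (metis yv v y nat_pow_comm group_commutes_pow)
  have "v [^] ((2::nat) ^ j) = (w \<otimes> w) [^] ((2::nat) ^ j) \<otimes> t [^] ((2::nat) ^ j)"
    unfolding v_def using w t wwt by (intro pow_mult_distrib) auto
  also have "(w \<otimes> w) [^] ((2::nat) ^ j) = w [^] ((2::nat) ^ Suc j)"
    using w nat_pow_pow[of w 2 "2 ^ j"] by (simp add: numeral_2_eq_2)
  finally have "v [^] ((2::nat) ^ j) = \<zero>" using Suc.prems(4) t by simp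
  then obtain M :: nat where "M > 0" "(y [^] c \<oplus> v) [^] M = (y [^] c) [^] M"
    using Suc.IH[of "y [^] c" v] y v ycv by auto
  then have "(y \<oplus> w) [^] (c * M) = y [^] (c * M)"
    using y w by (simp add: eq flip: nat_pow_pow)
  then show ?case using \<open>M > 0\<close> \<open>c > 0\<close> by (intro exI[of _ "c * M"]) simp
qed

end

section \<open>Additively closed nilpotents are closed under products\<close>

locale nil_additive_ring = ring +
  assumes nil_additive: "additive_subgroup (nilpotents R) R"
begin

lemma nil_add: "x \<in> nilpotents R \<Longrightarrow> y \<in> nilpotents R \<Longrightarrow> x \<oplus> y \<in> nilpotents R"
  using nil_additive by (rule additive_subgroup.a_closed)

lemma nil_uminus: "x \<in> nilpotents R \<Longrightarrow> \<ominus> x \<in> nilpotents R"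
  using nil_additive by (simp add: additive_subgroup.a_inv_closed abelian_group_axioms)

lemma nil_minus: "x \<in> nilpotents R \<Longrightarrow> y \<in> nilpotents R \<Longrightarrow> x \<ominus> y \<in> nilpotents R"
  by (simp add: a_minus_def nil_add nil_uminus)

lemma nil_pow_pos:
  assumes "x \<in> nilpotents R" "n > (0::nat)"
  shows "x [^] n \<in> nilpotents R"
proof -
  obtain j :: nat where "x [^] j = \<zero>" using assms(1) by (rule nilpotentsE)
  then have "(x [^] n) [^] j = \<zero>"
    using assms by (metis nat_pow_pow nat_pow_zero mult.commute nilpotents_closed neq0_conv)
  then show ?thesis using assms nilpotents_closed by (intro nilpotentsI) auto
qed

text \<open>Polarization of squaring: additive closure alone already yields this symmetric
  substitute for closure under products.\<close>

lemma nil_jordan: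
  assumes "x \<in> nilpotents R" "y \<in> nilpotents R"
  shows "x \<otimes> y \<oplus> y \<otimes> x \<in> nilpotents R"
proof -
  have c: "x \<in> carrier R" "y \<in> carrier R" using assms nilpotents_closed by auto
  have sq: "z \<otimes> z \<in> nilpotents R" if "z \<in> nilpotents R" for z
    using nil_pow_pos[OF that, of 2] nilpotents_closed[OF that] by (simp add: numeral_2_eq_2)
  have "(x \<oplus> y) \<otimes> (x \<oplus> y) \<ominus> x \<otimes> x \<ominus> y \<otimes> y \<in> nilpotents R"
    using assms by (intro nil_minus sq nil_add)
  also have "(x \<oplus> y) \<otimes> (x \<oplus> y) \<ominus> x \<otimes> x \<ominus> y \<otimes> y = x \<otimes> y \<oplus> y \<otimes> x"
    using c by algebra
  finally show ?thesis .
qed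

lemma nil_core_add: "x \<in> nil_core \<Longrightarrow> y \<in> nil_core \<Longrightarrow> x \<oplus> y \<in> nil_core"
  by (auto simp: nil_core_def l_distr nil_span_closed nil_add)

lemma nil_core_uminus: "x \<in> nil_core \<Longrightarrow> \<ominus> x \<in> nil_core"
  by (auto simp: nil_core_def l_minus nil_span_closed nil_uminus)

text \<open>Induction on \<open>s\<close> with \<open>a\<close> arbitrary, because the product case
  applies the hypothesis for \<open>w\<close> both to \<open>a\<close> and to the elements
  \<open>a \<otimes> s \<otimes> a\<close>.\<close>

lemma square_in_nil_core_mult:
  assumes "s \<in> nil_span" "a \<in> nil_span" "a \<otimes> a \<in> nil_core"
  shows "a \<otimes> s \<in> nilpotents R"
  using assms
proof (induction arbitrary: a rule: nil_span.induct)
  case (one a)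
  then have "a \<in> carrier R" by (simp add: nil_span_closed)
  moreover have "a [^] (2::nat) \<in> nilpotents R"
    using nil_core_subset_nilpotents[OF one(2)] \<open>a \<in> carrier R\<close> by (simp add: numeral_2_eq_2)
  ultimately show ?case using nilpotents_pow_imp by simp
next
  case (add s t a)
  then show ?case by (simp add: r_distr nil_span_closed nil_add)
next
  case (mult w y a)
  note S = nil_span_mult nil_span.add nil_span_pow nilpotents_subset_nil_span
  note C = nil_span_closed nil_core_closed
  have S1: "a \<in> nil_span" "w \<in> nil_span" "y \<in> nil_span" using mult S by auto
  then have car: "a \<in> carrier R" "w \<in> carrier R" "y \<in> carrier R" using C by auto
  have aw: "a \<otimes> w \<in> nilpotents R" using mult by blast
  \<comment> \<open>The square of \<open>a \<otimes> s \<otimes> a\<close> contains the factor a^2,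
    hence lies in the core. The induction hypothesis makes asaw nilpotent, and a cyclic swap turns
    this into awas.\<close>
  have awa: "a \<otimes> w \<otimes> a \<in> nil_core"
  proof -
    have "a \<otimes> w \<otimes> a \<otimes> s \<in> nilpotents R" if s: "s \<in> nil_span" for s
    proof -
      have "(a \<otimes> s) \<otimes> (a \<otimes> a) \<otimes> (s \<otimes> a) \<in> nil_core"
        using S1 s mult.prems by (simp add: nil_core_mult_nil_span nil_span_mult_nil_core S)
      then have "(a \<otimes> s \<otimes> a) \<otimes> w \<in> nilpotents R"
        using S1 s C by (intro mult.IH) (simp_all add: S m_assoc)
      then show ?thesis
        using nilpotents_swap[of "a \<otimes> s" "a \<otimes> w"] s C car by (simp add: m_assoc)
    qed
    then show ?thesis using car by (simp add: nil_core_def)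
  qed
  define c where "c = a \<otimes> w \<otimes> y \<oplus> y \<otimes> (a \<otimes> w)"
  have cN: "c \<in> nilpotents R" unfolding c_def using aw mult by (intro nil_jordan)
  have cS: "c \<in> nil_span" using cN S by blast
  define b where "b = a \<otimes> w \<otimes> y"
  have bS: "b \<in> nil_span" using S1 S by (simp add: b_def)
  \<comment> \<open>Modulo the core, right multiplication of aw by \<open>c\<close> is left
    multiplication by \<open>b\<close>: in awc = (awa)wy + b(aw) the first summand contains the core
    element awa.\<close>
  have step: "\<exists>i \<in> nil_core. a \<otimes> w \<otimes> c [^] j = b [^] j \<otimes> (a \<otimes> w) \<oplus> i" for j :: nat
  proof (induction j)
    case 0
    have "\<zero> \<in> nil_core"
      using awa nil_core_add nil_core_uminus car by (metis m_closed r_neg)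
    then show ?case using car by (intro bexI[of _ \<zero>]) auto
  next
    case (Suc j)
    then obtain i where i: "i \<in> nil_core" "a \<otimes> w \<otimes> c [^] j = b [^] j \<otimes> (a \<otimes> w) \<oplus> i" by blast
    have cc: "c \<in> carrier R" "b \<in> carrier R" "i \<in> carrier R" "b [^] j \<in> carrier R"
      using cS bS i C by auto
    have "a \<otimes> w \<otimes> c [^] Suc j = (a \<otimes> w \<otimes> c [^] j) \<otimes> c"
      using car cc by (simp add: m_assoc)
    also have "\<dots> = b [^] j \<otimes> (a \<otimes> w) \<otimes> c \<oplus> i \<otimes> c"
      using i car cc by (simp add: l_distr)
    also have "b [^] j \<otimes> (a \<otimes> w) \<otimes> c
        = b [^] Suc j \<otimes> (a \<otimes> w) \<oplus> b [^] j \<otimes> (a \<otimes> w \<otimes> a) \<otimes> (w \<otimes> y)"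
      using car cc by (simp add: c_def b_def r_distr m_assoc a_comm)
    also have "\<dots> \<oplus> i \<otimes> c
        = b [^] Suc j \<otimes> (a \<otimes> w) \<oplus> (b [^] j \<otimes> (a \<otimes> w \<otimes> a) \<otimes> (w \<otimes> y) \<oplus> i \<otimes> c)"
      using car cc by (simp add: a_assoc)
    finally have "a \<otimes> w \<otimes> c [^] Suc j
        = b [^] Suc j \<otimes> (a \<otimes> w) \<oplus> (b [^] j \<otimes> (a \<otimes> w \<otimes> a) \<otimes> (w \<otimes> y) \<oplus> i \<otimes> c)" .
    moreover have "b [^] j \<otimes> (a \<otimes> w \<otimes> a) \<otimes> (w \<otimes> y) \<oplus> i \<otimes> c \<in> nil_core"
      using awa i S1 bS cS
      by (intro nil_core_add) (simp_all add: nil_core_mult_nil_span nil_span_mult_nil_core S)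
    ultimately show ?case by blast
  qed
  obtain m :: nat where m: "c [^] m = \<zero>" using cN by (rule nilpotentsE)
  obtain i where i: "i \<in> nil_core" "a \<otimes> w \<otimes> c [^] m = b [^] m \<otimes> (a \<otimes> w) \<oplus> i"
    using step by blast
  have bc: "b \<in> carrier R" "i \<in> carrier R" using bS i C by auto
  \<comment> \<open>With c^m = 0 the congruence puts b^m(aw) into the core; multiplying by
    \<open>y\<close> on the right completes it to b^(m+1).\<close>
  have "b [^] m \<otimes> (a \<otimes> w) \<oplus> i = \<zero>" using i m car by simp
  then have "b [^] m \<otimes> (a \<otimes> w) = \<ominus> i" using bc car by (simp add: minus_equality)
  then have "b [^] m \<otimes> (a \<otimes> w) \<in> nil_core" using i nil_core_uminus by simp
  then have "b [^] m \<otimes> (a \<otimes> w) \<otimes> y \<in> nil_core" using S1(3) by (rule nil_core_mult_nil_span)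
  moreover have "b [^] m \<otimes> (a \<otimes> w) \<otimes> y = b [^] Suc m"
    using car bc by (simp add: b_def m_assoc)
  ultimately have "b \<in> nilpotents R"
    using nilpotents_pow_imp[OF bc(1)] nil_core_subset_nilpotents by metis
  then show ?case using car by (simp add: b_def m_assoc)
qed

text \<open>Within the span, square roots of core elements are core elements. Since n < 2^n, a^(2^n)
  = 0 lies in the core, and taking \<open>n\<close> square roots leads back to
  \<open>a\<close>.\<close>

lemma nilpotents_subset_nil_core:
  assumes "a \<in> nilpotents R"
  shows "a \<in> nil_core"
proof -
  have root: "x \<in> nil_core" if "x \<in> nil_span" "x \<otimes> x \<in> nil_core" for x
    unfolding nil_core_def using square_in_nil_core_mult[OF _ that] nil_span_closed[OF that(1)] by blast
  have iterate: "x \<in> nil_core" if "x \<in> nil_span" "x [^] ((2::nat) ^ j) \<in> nil_core" for x and j :: nat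
    using that
  proof (induction j arbitrary: x)
    case 0
    then show ?case by (simp add: nil_span_closed)
  next
    case (Suc j)
    have x: "x \<in> carrier R" using Suc.prems by (simp add: nil_span_closed)
    have "(x \<otimes> x) [^] ((2::nat) ^ j) = x [^] ((2::nat) ^ Suc j)"
      using x nat_pow_pow[of x 2 "2 ^ j"] by (simp add: numeral_2_eq_2)
    then have "x \<otimes> x \<in> nil_core" using Suc.prems by (simp only: Suc.IH nil_span_mult)
    then show ?case using root Suc.prems by blast
  qed
  obtain n :: nat where n: "a [^] n = \<zero>" using assms by (rule nilpotentsE)
  have "a [^] ((2::nat) ^ n) = a [^] n \<otimes> a [^] (2 ^ n - n)"
    using nilpotents_closed[OF assms] by (simp add: nat_pow_mult less_imp_le)
  then have "a [^] ((2::nat) ^ n) = \<zero>" using n nilpotents_closed[OF assms] by simp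
  moreover have "\<zero> \<in> nil_core"
    using nilpotentsI[of \<zero> 1] by (simp add: nil_core_def nil_span_closed)
  ultimately show ?thesis
    by (intro iterate[of a n] nilpotents_subset_nil_span[OF assms]) simp
qed

lemma nil_mult: "x \<in> nilpotents R \<Longrightarrow> y \<in> nilpotents R \<Longrightarrow> x \<otimes> y \<in> nilpotents R"
  using nilpotents_subset_nil_core nilpotents_subset_nil_span by (auto simp: nil_core_def)

section \<open>Multiplying nilpotents by idempotents and by potent elements\<close>

lemma idempotent_mult_nil:
  assumes e: "e \<in> carrier R" "e \<otimes> e = e" and s: "s \<in> nilpotents R"
  shows "e \<otimes> s \<in> nilpotents R"
proof -
  have sc: "s \<in> carrier R" using s by (rule nilpotents_closed)
  \<comment> \<open>Peirce decomposition along \<open>e\<close> and \<open>f\<close>. Off-diagonal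
    corners square to zero, so subtracting them from \<open>s\<close> leaves a nilpotent diagonal
    part \<open>d\<close>. Its corner ese is then nilpotent, and es = ese + esf.\<close>
  define f where "f = \<one> \<ominus> e"
  have f: "f \<in> carrier R" "e \<otimes> f = \<zero>" "f \<otimes> e = \<zero>" "e \<oplus> f = \<one>"
    using e unfolding f_def a_minus_def
    by (auto simp: r_distr l_distr r_minus l_minus r_neg) (simp add: a_lcomm[of e] r_neg)
  have off: "x \<otimes> s \<otimes> y \<in> nilpotents R"
    if "x \<in> carrier R" "y \<in> carrier R" "y \<otimes> x = \<zero>" for x y
  proof -
    have "(x \<otimes> s \<otimes> y) [^] (2::nat) = x \<otimes> s \<otimes> (y \<otimes> x) \<otimes> (s \<otimes> y)"
      using that(1,2) sc by (simp add: numeral_2_eq_2 m_assoc)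
    then have "(x \<otimes> s \<otimes> y) [^] (2::nat) = \<zero>" using that sc by simp
    then show ?thesis using that sc by (intro nilpotentsI) auto
  qed
  have esf: "e \<otimes> s \<otimes> f \<in> nilpotents R" and fse: "f \<otimes> s \<otimes> e \<in> nilpotents R"
    using off e f by auto
  define d where "d = e \<otimes> s \<otimes> e \<oplus> f \<otimes> s \<otimes> f"
  have dc: "d \<in> carrier R" using e f sc by (simp add: d_def)
  have "s = (e \<oplus> f) \<otimes> s \<otimes> (e \<oplus> f)" using f(4) sc by simp
  also have "\<dots> = d \<oplus> (e \<otimes> s \<otimes> f \<oplus> f \<otimes> s \<otimes> e)"
    using e f(1) sc by (simp add: d_def l_distr r_distr a_ac)
  finally have "d = s \<ominus> (e \<otimes> s \<otimes> f \<oplus> f \<otimes> s \<otimes> e)"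
    using dc e(1) f(1) sc
    by (metis (no_types) a_minus_def add.inv_solve_right add.m_closed m_closed)
  then have dN: "d \<in> nilpotents R" using s esf fse by (simp add: nil_minus nil_add)
  \<comment> \<open>As \<open>d\<close> is block diagonal, its powers agree with those of its
    \<open>e\<close>-corner after multiplication by \<open>e\<close>.\<close>
  have ese: "(e \<otimes> s \<otimes> e) [^] j \<otimes> e = d [^] j \<otimes> e" for j :: nat
  proof (induction j)
    case (Suc j)
    have ed: "e \<otimes> d = e \<otimes> s \<otimes> e" and de: "d \<otimes> e = e \<otimes> s \<otimes> e"
      using e f sc by (simp_all add: d_def l_distr r_distr m_assoc flip: m_assoc[of e e] m_assoc[of e f])
    have "(e \<otimes> s \<otimes> e) [^] Suc j \<otimes> e = (e \<otimes> s \<otimes> e) [^] j \<otimes> e \<otimes> (e \<otimes> s \<otimes> e)"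
      using e sc by (simp add: m_assoc) (metis e m_assoc m_closed)
    also have "\<dots> = d [^] j \<otimes> (e \<otimes> (e \<otimes> s \<otimes> e))" using Suc e sc dc by (simp add: m_assoc)
    also have "e \<otimes> (e \<otimes> s \<otimes> e) = d \<otimes> e" using e sc de by (metis m_assoc m_closed)
    finally show ?case using dc e by (simp add: m_assoc)
  qed (use e in simp)
  obtain n :: nat where "d [^] n = \<zero>" using dN by (rule nilpotentsE)
  then have "(e \<otimes> s \<otimes> e) [^] n \<otimes> e = \<zero>" using ese e by simp
  then have "(e \<otimes> s \<otimes> e) [^] Suc n = \<zero>"
    using e sc by simp (metis e m_assoc m_closed l_null nat_pow_closed)
  then have "e \<otimes> s \<otimes> e \<in> nilpotents R" using e sc by (intro nilpotentsI[of _ "Suc n"]) auto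
  then have "e \<otimes> s \<otimes> e \<oplus> e \<otimes> s \<otimes> f \<in> nilpotents R" using esf nil_add by blast
  then show ?thesis using e(1) f sc by (metis r_distr r_one m_closed)
qed

text \<open>\<open>v\<close> inverts \<open>p\<close> in the corner ring of the idempotent
  \<open>e'\<close>. Conjugation of \<open>n\<close> to pnv preserves nilpotency, since its cyclic
  swap vpn equals e'n. Pushing the factors \<open>p\<close> in (ps)^k to the right conjugates the
  factors \<open>s\<close>.\<close>

lemma potent_mult_nil:
  assumes p: "p \<in> carrier R" and k: "k \<ge> (2::nat)" and e: "p [^] k \<otimes> p = p"
    and s: "s \<in> nilpotents R"
  shows "p \<otimes> s \<in> nilpotents R"
proof -
  define e' where "e' = p [^] k"
  define v where "v = p [^] (k - 1)"
  have c: "e' \<in> carrier R" "v \<in> carrier R" "s \<in> carrier R"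
    using p s by (auto simp: e'_def v_def nilpotents_closed)
  have pv: "v \<otimes> p = e'" "p \<otimes> v = e'"
    using p k nat_pow_Suc2[OF p, of "k - 1"] nat_pow_Suc[of p "k - 1"]
    by (auto simp: v_def e'_def simp del: nat_pow_Suc)
  have e'p: "e' \<otimes> p = p" using e by (simp add: e'_def)
  have "v = p \<otimes> p [^] (k - 2)"
    using k nat_pow_Suc2[OF p, of "k - 2"] by (simp add: v_def Suc_diff_Suc numeral_2_eq_2 del: nat_pow_Suc)
  then have e'v: "e' \<otimes> v = v" using p c e'p by (simp flip: m_assoc)
  have idem: "e' \<otimes> e' = e'" using pv e'v c p by (metis e'p m_assoc)
  have conj: "p \<otimes> n \<otimes> v \<in> nilpotents R" if n: "n \<in> nilpotents R" for n
  proof -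
    have "e' \<otimes> n \<in> nilpotents R" using c idem n by (intro idempotent_mult_nil)
    then have "v \<otimes> (p \<otimes> n) \<in> nilpotents R"
      using pv p c nilpotents_closed[OF n] by (simp flip: m_assoc)
    then show ?thesis using nilpotents_swap p c nilpotents_closed[OF n] by simp
  qed
  \<comment> \<open>Inserting vp in front of the trailing power of \<open>p\<close> turns the
    coefficient \<open>n\<close> into the conjugate of sn, which is nilpotent by
    \<open>nil_mult\<close>.\<close>
  have step: "\<exists>n \<in> nilpotents R. (p \<otimes> s) [^] Suc j \<otimes> p = n \<otimes> p [^] (j + 2)" for j
  proof (induction j)
    case 0
    have "(p \<otimes> s) [^] Suc 0 \<otimes> p = p \<otimes> s \<otimes> (v \<otimes> p \<otimes> p)" using pv e'p p c by simp
    also have "\<dots> = (p \<otimes> s \<otimes> v) \<otimes> p [^] (0 + 2::nat)"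
      using p c by (simp add: m_assoc numeral_2_eq_2)
    finally show ?case using conj[OF s] by blast
  next
    case (Suc j)
    then obtain n where n: "n \<in> nilpotents R" "(p \<otimes> s) [^] Suc j \<otimes> p = n \<otimes> p [^] (j + 2)"
      by blast
    have nc: "n \<in> carrier R" using n by (simp add: nilpotents_closed)
    have "(p \<otimes> s) [^] Suc (Suc j) \<otimes> p = p \<otimes> s \<otimes> ((p \<otimes> s) [^] Suc j \<otimes> p)"
      using p c nat_pow_Suc2[of "p \<otimes> s" "Suc j"] by (simp add: m_assoc del: nat_pow_Suc)
    also have "\<dots> = p \<otimes> s \<otimes> (n \<otimes> p [^] (j + 2))" by (simp only: n)
    also have "p [^] (j + 2) = v \<otimes> p \<otimes> p [^] (j + 2)"
      using pv e'p p c nat_pow_Suc2[OF p, of "j + 1"] by (simp add: m_assoc[symmetric])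
    also have "\<dots> = v \<otimes> p [^] (Suc j + 2)"
      using p c nat_pow_Suc2[OF p, of "j + 2"] by (simp add: m_assoc)
    finally have "(p \<otimes> s) [^] Suc (Suc j) \<otimes> p = (p \<otimes> (s \<otimes> n) \<otimes> v) \<otimes> p [^] (Suc j + 2)"
      using p c nc by (simp add: m_assoc)
    then show ?case using conj[OF nil_mult[OF s n(1)]] by blast
  qed
  \<comment> \<open>The index \<open>k - 2\<close> makes the trailing power p^k = e', whence (ps)^k
    = n(e's), a product of two nilpotents.\<close>
  obtain n where n: "n \<in> nilpotents R" "(p \<otimes> s) [^] Suc (k - 2) \<otimes> p = n \<otimes> e'"
    using step[of "k - 2"] by (simp only: e'_def le_add_diff_inverse2[OF k]) blast
  have nc: "n \<in> carrier R" using n by (simp add: nilpotents_closed)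
  have "(p \<otimes> s) [^] Suc (Suc (k - 2)) = (p \<otimes> s) [^] Suc (k - 2) \<otimes> p \<otimes> s"
    using p c by (simp add: m_assoc)
  also have "\<dots> = n \<otimes> (e' \<otimes> s)" using c nc by (simp only: n(2) m_assoc)
  also have "\<dots> \<in> nilpotents R" using n(1) c idem s by (intro nil_mult idempotent_mult_nil)
  finally show ?thesis using p c by (blast intro: nilpotents_pow_imp)
qed

section \<open>Powers of a periodic plus a nilpotent element\<close>

lemma periodic_plus_nilpotent_pow:
  assumes p: "p \<in> carrier R" "periodic_elem R p" and q: "q \<in> nilpotents R"
  obtains k :: nat where "k > 0"
    "(p \<oplus> q) [^] (k + k) \<ominus> (p \<oplus> q) [^] k \<in> nilpotents R"
proof -
  obtain k :: nat where k: "k \<ge> 2" "p [^] (k + k) = p [^] k"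
    using p by (rule idempotent_power)
  \<comment> \<open>Fitting-type splitting of \<open>p\<close> by the idempotent \<open>e\<close>:
    \<open>u\<close> is the part on which \<open>p\<close> is invertible, and \<open>r\<close> = p(1
    - e) is the nilpotent part.\<close>
  define e where "e = p [^] k"
  define u where "u = p \<otimes> e"
  define r where "r = p \<ominus> u"
  have c: "e \<in> carrier R" "u \<in> carrier R" "r \<in> carrier R" "q \<in> carrier R"
    using p q by (auto simp: e_def u_def r_def nilpotents_closed)
  have idem: "e \<otimes> e = e" using k(2) p(1) by (simp add: e_def nat_pow_mult)
  have pe: "p \<otimes> e = e \<otimes> p" using p(1) unfolding e_def
    by (metis nat_pow_Suc nat_pow_Suc2)
  have ej: "e [^] Suc j = e" for j by (induction j) (use c idem in auto)
  have uk: "u [^] k = e"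
    using pe p c k ej[of "k - 1"] idem unfolding u_def by (simp add: pow_mult_distrib flip: e_def)
  have eu: "u [^] k \<otimes> u = u" using uk c idem p pe unfolding u_def by (metis m_assoc)
  \<comment> \<open>\<open>p\<close> commutes with \<open>e\<close>, so r^k = e(1 - e)^k, which
    vanishes because e(1 - e) = 0.\<close>
  have rN: "r \<in> nilpotents R"
  proof -
    have r': "r = p \<otimes> (\<one> \<ominus> e)" using p c by (simp add: r_def u_def a_minus_def r_distr r_minus)
    have comm: "p \<otimes> (\<one> \<ominus> e) = (\<one> \<ominus> e) \<otimes> p"
      using p c pe by (simp add: a_minus_def r_distr l_distr r_minus l_minus)
    have "r [^] k = e \<otimes> (\<one> \<ominus> e) [^] k"
      unfolding r' e_def by (rule pow_mult_distrib) (use comm p c in \<open>simp_all add: e_def\<close>)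
    also have "\<dots> = e \<otimes> (\<one> \<ominus> e) \<otimes> (\<one> \<ominus> e) [^] (k - 1)"
      using c k nat_pow_Suc2[of "\<one> \<ominus> e" "k - 1"] by (simp add: m_assoc del: nat_pow_Suc)
    also have "e \<otimes> (\<one> \<ominus> e) = \<zero>" using c idem by (simp add: a_minus_def r_distr r_minus r_neg)
    finally have "r [^] k = \<zero>" using c by simp
    then show ?thesis using c by (intro nilpotentsI)
  qed
  define s where "s = r \<oplus> q"
  have sN: "s \<in> nilpotents R" using rN q by (simp add: s_def nil_add)
  have sc: "s \<in> carrier R" using sN by (rule nilpotents_closed)
  have x: "p \<oplus> q = u \<oplus> s"
    using p c by (simp add: s_def r_def a_minus_def) (simp add: a_ac r_neg r_neg1 r_neg2)
  have left: "u \<otimes> n \<in> nilpotents R" if "n \<in> nilpotents R" for n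
    using that c k eu by (intro potent_mult_nil)
  have right: "n \<otimes> u \<in> nilpotents R" if "n \<in> nilpotents R" for n
    using that left nilpotents_swap c nilpotents_closed by blast
  have leftpow: "u [^] j \<otimes> n \<in> nilpotents R" if "n \<in> nilpotents R" for n and j :: nat
    using that
  proof (induction j arbitrary: n)
    case (Suc j)
    then show ?case using left c by (simp add: m_assoc nilpotents_closed)
  qed (simp add: nilpotents_closed)
  \<comment> \<open>Expanding one more factor produces u^j s, nu and ns besides the power of
    \<open>u\<close>; each of these is nilpotent.\<close>
  have approx: "\<exists>n \<in> nilpotents R. (u \<oplus> s) [^] j = u [^] j \<oplus> n" for j :: nat
  proof (induction j)
    case 0
    show ?case by (intro bexI[of _ \<zero>] nilpotentsI[of _ 1]) auto
  next
    case (Suc j)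
    then obtain n where n: "n \<in> nilpotents R" "(u \<oplus> s) [^] j = u [^] j \<oplus> n" by blast
    have nc: "n \<in> carrier R" using n by (simp add: nilpotents_closed)
    have "(u \<oplus> s) [^] Suc j = u [^] Suc j \<oplus> (u [^] j \<otimes> s \<oplus> n \<otimes> u \<oplus> n \<otimes> s)"
      using n nc sc c by (simp add: l_distr r_distr a_ac)
    moreover have "u [^] j \<otimes> s \<oplus> n \<otimes> u \<oplus> n \<otimes> s \<in> nilpotents R"
      using n sN by (intro nil_add leftpow right nil_mult)
    ultimately show ?case by blast
  qed
  \<comment> \<open>Both exponents give the same leading term, since u^(2k) = ee = e = u^k; it
    cancels in the difference.\<close>
  obtain m where m: "m \<in> nilpotents R" "(u \<oplus> s) [^] (k + k) = e \<oplus> m"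
    using approx[of "k + k"] uk idem c by (auto simp flip: nat_pow_mult)
  obtain n where n: "n \<in> nilpotents R" "(u \<oplus> s) [^] k = e \<oplus> n"
    using approx[of k] uk by auto
  have mc: "m \<in> carrier R" "n \<in> carrier R" using m n nilpotents_closed by auto
  have "(e \<oplus> m) \<ominus> (e \<oplus> n) = m \<ominus> n"
    using c mc by (simp add: a_minus_def minus_add a_lcomm[of m] a_assoc r_neg1 r_neg2)
  then have "(p \<oplus> q) [^] (k + k) \<ominus> (p \<oplus> q) [^] k \<in> nilpotents R"
    using m n by (simp add: x nil_minus)
  then show ?thesis using k by (intro that[of k]) auto
qed

end

section \<open>Positive characteristic and periodicity\<close>

theorem proposition2p11:
  fixes R :: "('a, 'b) ring_scheme"
  assumes "semi_nil_clean_ring R"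
    and "additive_subgroup (nilpotents R) R"
    and "\<exists>d :: nat. d > 0 \<and> (\<forall>x \<in> nilpotents R. x [^]\<^bsub>R\<^esub> d = \<zero>\<^bsub>R\<^esub>)"
  shows "periodic_ring R"
proof -
  interpret ring R using assms(1) by (simp add: semi_nil_clean_ring_def)
  interpret nil_additive_ring R by (intro_locales, unfold nil_additive_ring_axioms_def, rule assms(2))
  have key: "\<exists>k :: nat. k > 0 \<and> x [^]\<^bsub>R\<^esub> (k + k) \<ominus>\<^bsub>R\<^esub> x [^]\<^bsub>R\<^esub> k \<in> nilpotents R"
    if "x \<in> carrier R" for x
    using assms(1) that periodic_plus_nilpotent_pow unfolding semi_nil_clean_ring_def by metis
  obtain c :: nat where c: "c > 0" "\<And>x. x \<in> carrier R \<Longrightarrow> add_pow R c x = \<zero>\<^bsub>R\<^esub>"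
  proof -
    obtain k :: nat where k: "k > 0" "(add_pow R (2::nat) \<one>\<^bsub>R\<^esub>) [^]\<^bsub>R\<^esub> (k + k)
        \<ominus>\<^bsub>R\<^esub> (add_pow R (2::nat) \<one>\<^bsub>R\<^esub>) [^]\<^bsub>R\<^esub> k \<in> nilpotents R"
      using key[of "add_pow R (2::nat) \<one>\<^bsub>R\<^esub>"] by auto
    \<comment> \<open>The nilpotent difference for the element 2 is \<open>b\<close> times 1, with
      \<open>b\<close> positive. Some power of it vanishes, so the positive integer b^j annihilates
      the ring.\<close>
    define b :: nat where "b = 2 ^ (k + k) - 2 ^ k"
    have lt: "(2::nat) ^ k < 2 ^ (k + k)" using k(1) by simp
    have "add_pow R ((2::nat) ^ (k + k)) \<one>\<^bsub>R\<^esub>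
        = add_pow R b \<one>\<^bsub>R\<^esub> \<oplus>\<^bsub>R\<^esub> add_pow R ((2::nat) ^ k) \<one>\<^bsub>R\<^esub>"
      using lt by (simp add: b_def add.nat_pow_mult del: power_strict_increasing_iff)
    then have "add_pow R b \<one>\<^bsub>R\<^esub> \<in> nilpotents R"
      using k(2) by (simp only: nat_multiple_one_pow) (simp add: a_minus_def a_assoc r_neg)
    then obtain j :: nat where "(add_pow R b \<one>\<^bsub>R\<^esub>) [^]\<^bsub>R\<^esub> j = \<zero>\<^bsub>R\<^esub>"
      by (rule nilpotentsE)
    then have one0: "add_pow R (b ^ j) \<one>\<^bsub>R\<^esub> = \<zero>\<^bsub>R\<^esub>" by (simp only: nat_multiple_one_pow)
    have "add_pow R (b ^ j) x = \<zero>\<^bsub>R\<^esub>" if "x \<in> carrier R" for x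
      using that one0 add_pow_ldistr[of "\<one>\<^bsub>R\<^esub>" x "b ^ j"] by simp
    moreover have "b ^ j > 0" using lt by (simp add: b_def)
    ultimately show ?thesis by (rule that[rotated])
  qed
  have "periodic_elem R x" if x: "x \<in> carrier R" for x
  proof -
    obtain k :: nat where k: "k > 0" "x [^]\<^bsub>R\<^esub> (k + k) \<ominus>\<^bsub>R\<^esub> x [^]\<^bsub>R\<^esub> k \<in> nilpotents R"
      using key x by blast
    define z where "z = x [^]\<^bsub>R\<^esub> k"
    \<comment> \<open>\<open>w\<close> is nilpotent and commutes with \<open>z\<close>, and z + w =
      z^2. Removing \<open>w\<close> after taking a suitable power \<open>M\<close> gives z^(2M) =
      z^M.\<close>
    define w where "w = z \<otimes>\<^bsub>R\<^esub> z \<ominus>\<^bsub>R\<^esub> z"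
    have zc: "z \<in> carrier R" "w \<in> carrier R" using x by (auto simp: z_def w_def)
    have "w \<in> nilpotents R" using k x by (simp add: w_def z_def nat_pow_mult)
    then obtain n :: nat where n: "w [^]\<^bsub>R\<^esub> n = \<zero>\<^bsub>R\<^esub>" by (rule nilpotentsE)
    \<comment> \<open>The killing exponent is enlarged to a power of two so that it can be halved
      repeatedly.\<close>
    have "w [^]\<^bsub>R\<^esub> ((2::nat) ^ n) = w [^]\<^bsub>R\<^esub> n \<otimes>\<^bsub>R\<^esub> w [^]\<^bsub>R\<^esub> (2 ^ n - n)"
      using zc by (simp add: nat_pow_mult less_imp_le)
    then have w0: "w [^]\<^bsub>R\<^esub> ((2::nat) ^ n) = \<zero>\<^bsub>R\<^esub>" using n zc by simp
    have comm: "z \<otimes>\<^bsub>R\<^esub> w = w \<otimes>\<^bsub>R\<^esub> z"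
      using zc(1) by (simp add: w_def a_minus_def r_distr l_distr r_minus l_minus m_assoc)
    have zw: "z \<oplus>\<^bsub>R\<^esub> w = z \<otimes>\<^bsub>R\<^esub> z"
      using zc(1) by (simp add: w_def a_minus_def a_lcomm[of z] r_neg)
    obtain M :: nat where M: "M > 0" "(z \<otimes>\<^bsub>R\<^esub> z) [^]\<^bsub>R\<^esub> M = z [^]\<^bsub>R\<^esub> M"
      using pow_eq_of_nilpotent_difference[OF c(2,1) zc comm w0] zw by auto
    have "x [^]\<^bsub>R\<^esub> ((k + k) * M) = x [^]\<^bsub>R\<^esub> (k * M)"
      using M(2) x by (simp add: z_def nat_pow_mult nat_pow_pow)
    moreover have "(k + k) * M > 0" "k * M > 0" "(k + k) * M \<noteq> k * M" using k(1) M(1) by auto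
    ultimately show ?thesis unfolding periodic_elem_def by blast
  qed
  then show ?thesis by (simp add: periodic_ring_def ring_axioms)
qed

end
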